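(* Let $p\in\mathbb{C}^*$, $\alpha_1=2p$, $\widehat{\alpha}_1=p$, $\beta_1=\widehat{\beta}_1=0$, $\gamma_1=1$, $\widehat{\gamma}_1=-1$, and let $\phi_{i,j}(\partial,\lambda),\varphi_{i,j}(\partial,\lambda)\in\mathbb{C}[\partial,\lambda]$ for $i,j\in\mathbb{Z}_+$. Then the $\mathbb{Z}_2$-graded $\mathbb{C}[\partial]$-module $\mathcal{GS}(\alpha_1,\beta_1,\gamma_1,\widehat{\alpha}_1,\widehat{\beta}_1,\widehat{\gamma}_1,\{\phi_{i,j},\varphi_{i,j}\})$ with its $\lambda$-brackets is a Lie conformal superalgebra if and only if there exists $\Delta\in\mathbb{C}$ such that for all $i,j\in\mathbb{Z}_+$ $$\varphi_{i,j}(\partial,\lambda)=\Delta\quad\text{and}\quad \phi_{i,j}(\partial,\lambda)=\Delta\big((i+p)\partial+(i+j+p)\lambda\big).$$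
   Context: $\mathbb{C}^*$ is the set of nonzero complex numbers, $\mathbb{Z}_+$ the nonnegative integers, $\mathbb{Z}_2=\{\bar0,\bar1\}$, and $|x|$ is the parity of a homogeneous element. A Lie conformal superalgebra is a $\mathbb{Z}_2$-graded $\mathbb{C}[\partial]$-module $S=S_{\bar0}\oplus S_{\bar1}$ with a $\mathbb{C}$-bilinear parity-preserving $\lambda$-bracket $[\cdot\,{}_\lambda\,\cdot]:S\otimes S\to\mathbb{C}[\lambda]\otimes S$ satisfying $[\partial a\,{}_\lambda\, b]=-\lambda[a\,{}_\lambda\, b]$, $[a\,{}_\lambda\,\partial b]=(\partial+\lambda)[a\,{}_\lambda\, b]$, $[a\,{}_\lambda\, b]=-(-1)^{|a||b|}[b\,{}_{-\lambda-\partial}\,a]$ and $[a\,{}_\lambda\,[b\,{}_\mu\, c]]=[[a\,{}_\lambda\, b]\,{}_{\lambda+\mu}\, c]+(-1)^{|a||b|}[b\,{}_\mu\,[a\,{}_\lambda\, c]]$. $\mathcal{GS}(\alpha_1,\beta_1,\gamma_1,\widehat{\alpha}_1,\widehat{\beta}_1,\widehat{\gamma}_1,\{\phi_{i,j},\varphi_{i,j}\})=\mathcal{GS}_{\bar0}\oplus\mathcal{GS}_{\bar1}$ is the $\mathbb{Z}_2$-graded free $\mathbb{C}[\partial]$-module with $\mathcal{GS}_{\bar0}=\bigoplus_{i\in\mathbb{Z}_+}\mathbb{C}[\partial]L_i\oplus\bigoplus_{i\in\mathbb{Z}_+}\mathbb{C}[\partial]W_i$ and $\mathcal{GS}_{\bar1}=\bigoplus_{i\in\mathbb{Z}_+}\mathbb{C}[\partial]G_i\oplus\bigoplus_{i\in\mathbb{Z}_+}\mathbb{C}[\partial]H_i$,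 equipped with the $\lambda$-brackets (for $i,j\in\mathbb{Z}_+$) $[L_i\,{}_\lambda\, L_j]=((i+p)\partial+(i+j+2p)\lambda)L_{i+j}$, $[L_i\,{}_\lambda\, W_j]=((i+p)\partial+(i+j+p)\lambda)W_{i+j}$, $[L_i\,{}_\lambda\, G_j]=((i+p)(\partial+\beta_1)+(i+j+\alpha_1)\lambda)G_{i+j}$, $[W_i\,{}_\lambda\, G_j]=\gamma_1G_{i+j}$, $[L_i\,{}_\lambda\, H_j]=((i+p)(\partial+\widehat{\beta}_1)+(i+j+\widehat{\alpha}_1)\lambda)H_{i+j}$, $[W_i\,{}_\lambda\, H_j]=\widehat{\gamma}_1H_{i+j}$, $[G_i\,{}_\lambda\, H_j]=\phi_{i,j}(\partial,\lambda)W_{i+j}+\varphi_{i,j}(\partial,\lambda)L_{i+j}$, $[W_i\,{}_\lambda\, W_j]=[G_i\,{}_\lambda\, G_j]=[H_i\,{}_\lambda\, H_j]=0$, where brackets of the remaining ordered pairs of basis elements are defined by the skew-symmetry axiom, and the brackets are extended to all elements by the sesquilinearity rules $[\partial a\,{}_\lambda\, b]=-\lambda[a\,{}_\lambda\, b]$, $[a\,{}_\lambda\,\partial b]=(\partial+\lambda)[a\,{}_\lambda\, b]$. *)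

theory Defs
  imports Complex_Main "HOL-Computational_Algebra.Polynomial"
    "HOL-Library.Poly_Mapping" "HOL-Library.Z2"
begin

text \<open>
  A \<open>\<complex>[\<partial>]\<close>-module \<open>S\<close> is a type \<open>'s\<close> with a scalar multiplication by \<^typ>\<open>complex poly\<close>;
  \<open>\<partial>\<close> acts as the scalar \<open>[:0, 1:]\<close>. The space \<open>\<complex>[\<lambda>] \<otimes> S\<close> is \<open>'s poly\<close>, the coefficient of
  \<open>\<lambda>^n\<close> being an element of \<open>S\<close>; multiplication by \<open>\<lambda>\<close> is \<open>pCons 0\<close>. The space
  \<open>\<complex>[\<lambda>, \<mu>] \<otimes> S\<close> is \<open>'s poly poly\<close>, with \<open>\<mu>\<close> the outer and \<open>\<lambda>\<close> the inner variable.
\<close>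

text \<open>
  \<open>subst_op X e (\<Sum>n. \<lambda>^n s\<^sub>n) = \<Sum>n. X^n (e s\<^sub>n)\<close>: substitution of the operator \<open>X\<close> on \<open>M\<close>
  for \<open>\<lambda>\<close>, along a map \<open>e\<close> from \<open>S\<close> to \<open>M\<close>.
\<close>

definition subst_op ::
  "('m \<Rightarrow> 'm) \<Rightarrow> ('s \<Rightarrow> 'm) \<Rightarrow> 's::zero poly \<Rightarrow> 'm::comm_monoid_add" where
  "subst_op X e f = (\<Sum>n\<le>Polynomial.degree f. (X ^^ n) (e (coeff f n)))"

definition mult_lam :: "'s::ab_group_add poly poly \<Rightarrow> 's poly poly" where
  "mult_lam = map_poly (pCons 0)"

definition mult_mu :: "'s::ab_group_add poly poly \<Rightarrow> 's poly poly" where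
  "mult_mu = pCons 0"

text \<open>The substitution \<open>\<lambda> \<mapsto> -\<lambda> - \<partial>\<close> in \<open>\<complex>[\<lambda>] \<otimes> S\<close>, where \<open>D\<close> is the action of \<open>\<partial>\<close> on \<open>S\<close>.\<close>

definition skew_subst :: "('s \<Rightarrow> 's) \<Rightarrow> 's::ab_group_add poly \<Rightarrow> 's poly" where
  "skew_subst D = subst_op (\<lambda>f. - pCons 0 f - map_poly D f) (\<lambda>s. [:s:])"

text \<open>\<open>super_sign i j x = (-1)^(ij) x\<close>\<close>

definition super_sign :: "bit \<Rightarrow> bit \<Rightarrow> 'm \<Rightarrow> 'm::ab_group_add" where
  "super_sign i j x = (if i = 1 \<and> j = 1 then - x else x)"

locale lie_conformal_superalgebra = module scale
  for scale :: "complex poly \<Rightarrow> 's::ab_group_add \<Rightarrow> 's" +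
  fixes grade :: "bit \<Rightarrow> 's set"
    and br :: "'s \<Rightarrow> 's \<Rightarrow> 's poly"
  assumes grade_subspace: "\<And>i. subspace (grade i)"
    and grade_inter: "grade 0 \<inter> grade 1 = {0}"
    and grade_sum: "\<And>x. \<exists>a\<in>grade 0. \<exists>b\<in>grade 1. x = a + b"
    and br_add_left: "\<And>a a' b. br (a + a') b = br a b + br a' b"
    and br_add_right: "\<And>a b b'. br a (b + b') = br a b + br a b'"
    and br_scalar_left: "\<And>c a b. br (scale [:c:] a) b = map_poly (scale [:c:]) (br a b)"
    and br_scalar_right: "\<And>c a b. br a (scale [:c:] b) = map_poly (scale [:c:]) (br a b)"
    and br_parity:
      "\<And>i j a b n. a \<in> grade i \<Longrightarrow> b \<in> grade j \<Longrightarrow> coeff (br a b) n \<in> grade (i + j)"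
    and br_D_left: "\<And>a b. br (scale [:0, 1:] a) b = - pCons 0 (br a b)"
    and br_D_right:
      "\<And>a b. br a (scale [:0, 1:] b) = map_poly (scale [:0, 1:]) (br a b) + pCons 0 (br a b)"
    and br_skew:
      "\<And>i j a b. a \<in> grade i \<Longrightarrow> b \<in> grade j \<Longrightarrow>
         br a b = - super_sign i j (skew_subst (scale [:0, 1:]) (br b a))"
    and br_jacobi:
      "\<And>i j a b c. a \<in> grade i \<Longrightarrow> b \<in> grade j \<Longrightarrow>
         subst_op mult_mu (\<lambda>d. subst_op mult_lam (\<lambda>s. [:[:s:]:]) (br a d)) (br b c) =
         subst_op mult_lam
           (\<lambda>d. subst_op (\<lambda>f. mult_lam f + mult_mu f) (\<lambda>s. [:[:s:]:]) (br d c)) (br a b) +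
         super_sign i j
           (subst_op mult_lam (\<lambda>d. subst_op mult_mu (\<lambda>s. [:[:s:]:]) (br b d)) (br a c))"

text \<open>\<open>\<complex>[\<partial>, \<lambda>]\<close> is \<open>\<complex>[\<partial>][\<lambda>]\<close>, that is, \<^typ>\<open>complex poly poly\<close> with outer variable \<open>\<lambda>\<close>.\<close>

definition cst :: "complex \<Rightarrow> complex poly poly" where "cst c = [:[:c:]:]"
definition del :: "complex poly poly" where "del = [:[:0, 1:]:]"
definition lam :: "complex poly poly" where "lam = [:0, 1:]"

datatype gen = L nat | W nat | G nat | H nat

fun gen_parity :: "gen \<Rightarrow> bit" where
  "gen_parity (L i) = 0"
| "gen_parity (W i) = 0"
| "gen_parity (G i) = 1"
| "gen_parity (H i) = 1"

text \<open>The free \<open>\<complex>[\<partial>]\<close>-module on the generators: finitely supported coefficient functions.\<close>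

type_synonym gs = "gen \<Rightarrow>\<^sub>0 complex poly"

definition gs_scale :: "complex poly \<Rightarrow> gs \<Rightarrow> gs" where
  "gs_scale q = Poly_Mapping.map ((*) q)"

definition gs_grade :: "bit \<Rightarrow> gs set" where
  "gs_grade i = {x. \<forall>g \<in> Poly_Mapping.keys x. gen_parity g = i}"

text \<open>\<open>gs_term P g = P(\<partial>, \<lambda>) g\<close> as an element of \<open>\<complex>[\<lambda>] \<otimes> GS\<close>.\<close>

definition gs_term :: "complex poly poly \<Rightarrow> gen \<Rightarrow> gs poly" where
  "gs_term P g = map_poly (Poly_Mapping.single g) P"

text \<open>\<open>poly_op q X f = q(X) f\<close> for a \<open>\<complex>\<close>-linear operator \<open>X\<close> on \<open>\<complex>[\<lambda>] \<otimes> GS\<close>.\<close>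

definition poly_op :: "complex poly \<Rightarrow> (gs poly \<Rightarrow> gs poly) \<Rightarrow> gs poly \<Rightarrow> gs poly" where
  "poly_op q X f =
     (\<Sum>n\<le>Polynomial.degree q. map_poly (gs_scale [:coeff q n:]) ((X ^^ n) f))"

context
  fixes p \<alpha> \<beta> \<gamma> \<alpha>' \<beta>' \<gamma>' :: complex
    and phi vphi :: "nat \<Rightarrow> nat \<Rightarrow> complex poly poly"
begin

text \<open>The prescribed brackets of generators; \<open>None\<close> marks the pairs left to skew-symmetry.\<close>

fun gs_prescribed :: "gen \<Rightarrow> gen \<Rightarrow> gs poly option" where
  "gs_prescribed (L i) (L j) = Some (gs_term
     (cst (of_nat i + p) * del + cst (of_nat i + of_nat j + 2 * p) * lam) (L (i + j)))"
| "gs_prescribed (L i) (W j) = Some (gs_term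
     (cst (of_nat i + p) * del + cst (of_nat i + of_nat j + p) * lam) (W (i + j)))"
| "gs_prescribed (L i) (G j) = Some (gs_term
     (cst (of_nat i + p) * (del + cst \<beta>) + cst (of_nat i + of_nat j + \<alpha>) * lam) (G (i + j)))"
| "gs_prescribed (W i) (G j) = Some (gs_term (cst \<gamma>) (G (i + j)))"
| "gs_prescribed (L i) (H j) = Some (gs_term
     (cst (of_nat i + p) * (del + cst \<beta>') + cst (of_nat i + of_nat j + \<alpha>') * lam) (H (i + j)))"
| "gs_prescribed (W i) (H j) = Some (gs_term (cst \<gamma>') (H (i + j)))"
| "gs_prescribed (G i) (H j) =
     Some (gs_term (phi i j) (W (i + j)) + gs_term (vphi i j) (L (i + j)))"
| "gs_prescribed (W i) (W j) = Some 0"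
| "gs_prescribed (G i) (G j) = Some 0"
| "gs_prescribed (H i) (H j) = Some 0"
| "gs_prescribed _ _ = None"

definition gs_gen_br :: "gen \<Rightarrow> gen \<Rightarrow> gs poly" where
  "gs_gen_br g h = (case gs_prescribed g h of
      Some f \<Rightarrow> f
    | None \<Rightarrow> - super_sign (gen_parity g) (gen_parity h)
                (skew_subst (gs_scale [:0, 1:]) (the (gs_prescribed h g))))"

text \<open>
  Sesquilinear extension:
  \<open>[q(\<partial>) g \<^sub>\<lambda> r(\<partial>) h] = q(-\<lambda>) r(\<partial> + \<lambda>) [g \<^sub>\<lambda> h]\<close>.
\<close>

definition gs_br :: "gs \<Rightarrow> gs \<Rightarrow> gs poly" where
  "gs_br x y = (\<Sum>g\<in>Poly_Mapping.keys x. \<Sum>h\<in>Poly_Mapping.keys y.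
     poly_op (Poly_Mapping.lookup x g) (\<lambda>f. - pCons 0 f)
       (poly_op (Poly_Mapping.lookup y h) (\<lambda>f. map_poly (gs_scale [:0, 1:]) f + pCons 0 f)
         (gs_gen_br g h)))"

end

end

theory Submission
  imports Defs
begin

text \<open>
  An element of \<open>\<complex>[\<lambda>] \<otimes> GS\<close> or \<open>\<complex>[\<lambda>, \<mu>] \<otimes> GS\<close> is determined by the values of its coordinates at
  all complex \<open>\<partial>, \<lambda>, \<mu>\<close>. Under evaluation \<open>[q(\<partial>) a \<^sub>\<lambda> r(\<partial>) b]\<close> becomes \<open>q(-\<lambda>) r(\<partial> + \<lambda>) [a \<^sub>\<lambda> b]\<close>, so
  each term of the Jacobi identity at \<open>x, y, z\<close> carries the same factor
  \<open>x(-\<lambda>) y(-\<mu>) z(\<partial> + \<lambda> + \<mu>)\<close>, and the axioms reduce to numerical identities between the values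
  of the structure polynomials on generators.

  For necessity, the Jacobi identity for \<open>(W\<^sub>i, G\<^sub>j, H\<^sub>k)\<close> shows that the \<open>L\<close>-part \<open>vphi i j\<close>
  does not involve \<open>\<lambda>\<close> and depends on \<open>i + j\<close> only; the one for \<open>(L\<^sub>i, G\<^sub>j, H\<^sub>k)\<close> then makes it a
  constant \<open>\<Delta>\<close>. The difference between the \<open>W\<close>-part \<open>phi\<close> and its asserted value is likewise a
  function \<open>w\<^sub>i\<^sub>+\<^sub>j(\<partial>)\<close>, and the identity for \<open>(L\<^sub>i, G\<^sub>j, H\<^sub>k)\<close> forces it to vanish. The only delicate
  index is \<open>n = -p\<close>, where \<open>w\<^sub>n\<close> is compared with \<open>w\<^sub>n\<^sub>+\<^sub>1 = 0\<close>.
\<close>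

section \<open>Additive maps and operator substitution\<close>

text \<open>Applying \<open>e\<close> may kill leading coefficients and lower the degree; the sum
  may still run up to \<open>degree f\<close>, since the extra terms vanish.\<close>

lemma poly_map_poly_sum:
  fixes e :: "'a::zero \<Rightarrow> complex"
  assumes "e 0 = 0"
  shows "poly (map_poly e f) t = (\<Sum>n\<le>degree f. t ^ n * e (coeff f n))"
proof -
  have "poly (map_poly e f) t = (\<Sum>n\<le>degree (map_poly e f). coeff (map_poly e f) n * t ^ n)"
    by (rule poly_altdef)
  also have "\<dots> = (\<Sum>n\<le>degree f. coeff (map_poly e f) n * t ^ n)"
    by (rule sum.mono_neutral_left) (auto simp: map_poly_degree_leq coeff_eq_0)
  finally show ?thesis
    using assms by (simp add: coeff_map_poly mult.commute)
qed

lemma map_poly_add: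
  fixes e :: "'a::comm_monoid_add \<Rightarrow> 'b::comm_monoid_add"
  assumes "e 0 = 0" and "\<And>a b. e (a + b) = e a + e b"
  shows "map_poly e (f + g) = map_poly e f + map_poly e g"
  by (rule poly_eqI) (simp add: coeff_map_poly assms)

lemma additive_uminus:
  fixes e :: "'a::ab_group_add \<Rightarrow> complex"
  assumes "\<And>a b. e (a + b) = e a + e b"
  shows "e (- a) = - e a"
proof -
  have "e 0 = 0" using assms[of 0 0] by simp
  then show ?thesis using assms[of a "- a"] by (simp add: eq_neg_iff_add_eq_0 add.commute)
qed

lemma additive_sum:
  fixes e :: "'a::comm_monoid_add \<Rightarrow> complex"
  assumes "\<And>a b. e (a + b) = e a + e b" and "e 0 = 0"
  shows "e (\<Sum>i\<in>I. f i) = (\<Sum>i\<in>I. e (f i))"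
  by (induction I rule: infinite_finite_induct) (simp_all add: assms)

text \<open>An additive \<open>E\<close> that turns the operator \<open>X\<close> into
  multiplication by \<open>t\<close> turns substitution of \<open>X\<close> into evaluation at
  \<open>t\<close>. All substitutions in the skew-symmetry and Jacobi axioms are computed this
  way.\<close>

lemma additive_subst_op:
  fixes E :: "'m::comm_monoid_add \<Rightarrow> complex"
  assumes "\<And>a b. E (a + b) = E a + E b" and "E 0 = 0"
    and "\<And>y. E (X y) = t * E y" and "E (e 0) = 0"
  shows "E (subst_op X e f) = poly (map_poly (\<lambda>s. E (e s)) f) t"
proof -
  have "E ((X ^^ n) y) = t ^ n * E y" for n y
    by (induction n) (simp_all add: assms(3))
  then show ?thesis
    by (simp add: subst_op_def additive_sum[of E, OF assms(1,2)] poly_map_poly_sum assms(4))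
qed

section \<open>Point evaluations of coordinates\<close>

definition ev1 :: "gen \<Rightarrow> complex \<Rightarrow> complex \<Rightarrow> gs poly \<Rightarrow> complex" where
  "ev1 g d l f = poly (map_poly (\<lambda>s. poly (Poly_Mapping.lookup s g) d) f) l"

text \<open>As in \<open>ev1\<close>, \<open>d\<close> and \<open>l\<close> are the values of
  \<partial> and \<lambda>; \<open>m\<close> is the value of the outer variable \<mu>.\<close>

definition ev2 :: "gen \<Rightarrow> complex \<Rightarrow> complex \<Rightarrow> complex \<Rightarrow> gs poly poly \<Rightarrow> complex" where
  "ev2 g d l m F = poly (map_poly (ev1 g d l) F) m"

definition pe :: "complex poly poly \<Rightarrow> complex \<Rightarrow> complex \<Rightarrow> complex" where
  "pe P d l = poly (poly P [:l:]) d"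

text \<open>A nonzero polynomial in \<lambda> over the integral domain of polynomials in \<partial>
  has finitely many roots, whereas \<open>P - Q\<close> would vanish at every constant
  \<open>[:l:]\<close>.\<close>

lemma pe_eqI:
  assumes "\<And>d l. pe P d l = pe Q d l"
  shows "P = Q"
proof (rule ccontr)
  assume "P \<noteq> Q"
  then have "finite {q. poly (P - Q) q = 0}"
    by (intro poly_roots_finite) simp
  moreover have "range (\<lambda>l. [:l:]) \<subseteq> {q. poly (P - Q) q = 0}"
    using assms by (auto simp: pe_def poly_eq_poly_eq_iff[symmetric])
  ultimately have "finite (range (\<lambda>l::complex. [:l:]))"
    by (rule finite_subset[rotated])
  then have "finite (UNIV :: complex set)"
    by (rule finite_imageD) (simp add: inj_on_def)
  then show False
    by (simp add: infinite_UNIV_char_0)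
qed

lemma ev1_add [simp]: "ev1 g d l (f + f') = ev1 g d l f + ev1 g d l f'"
  by (simp add: ev1_def map_poly_add lookup_add)

lemma ev1_0 [simp]: "ev1 g d l 0 = 0"
  by (simp add: ev1_def)

lemma ev1_pCons [simp]:
  "ev1 g d l (pCons s f) = poly (Poly_Mapping.lookup s g) d + l * ev1 g d l f"
  by (simp add: ev1_def map_poly_pCons)

lemma ev1_uminus [simp]: "ev1 g d l (- f) = - ev1 g d l f"
  by (rule additive_uminus) simp

lemma ev1_diff [simp]: "ev1 g d l (f - f') = ev1 g d l f - ev1 g d l f'"
  using ev1_add[of g d l f "- f'"] by simp

lemma ev1_sum: "ev1 g d l (\<Sum>i\<in>I. f i) = (\<Sum>i\<in>I. ev1 g d l (f i))"
  by (rule additive_sum) simp_all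

lemma lookup_gs_scale [simp]:
  "Poly_Mapping.lookup (gs_scale q x) g = q * Poly_Mapping.lookup x g"
  by (simp add: gs_scale_def Poly_Mapping.map.rep_eq when_def)

lemma gs_scale_0_right [simp]: "gs_scale q 0 = 0"
  by (rule poly_mapping_eqI) simp

lemma ev1_scale [simp]: "ev1 g d l (map_poly (gs_scale q) f) = poly q d * ev1 g d l f"
  by (induction f) (simp_all add: map_poly_pCons algebra_simps)

text \<open>A complex polynomial vanishing everywhere is zero; this is used first in \<lambda> and
  then in \<partial>. Keeping \<open>g\<close> fixed lets it control the support of a bracket one
  generator at a time.\<close>

lemma lookup_coeff_eq_0I:
  assumes "\<And>d l. ev1 g d l f = 0"
  shows "Poly_Mapping.lookup (coeff f n) g = 0"
proof -
  have "map_poly (\<lambda>s. poly (Poly_Mapping.lookup s g) d) f = 0" for d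
    using assms by (simp add: ev1_def poly_eq_poly_eq_iff[symmetric] fun_eq_iff)
  then have "coeff (map_poly (\<lambda>s. poly (Poly_Mapping.lookup s g) d) f) n = 0" for d
    by simp
  then show ?thesis
    by (simp add: coeff_map_poly poly_eq_poly_eq_iff[symmetric] fun_eq_iff)
qed

lemma ev1_eqI:
  assumes "\<And>g d l. ev1 g d l f = ev1 g d l f'"
  shows "f = f'"
proof (rule poly_eqI, rule poly_mapping_eqI)
  fix n g
  have "Poly_Mapping.lookup (coeff (f - f') n) g = 0"
    by (rule lookup_coeff_eq_0I) (simp add: assms)
  then show "Poly_Mapping.lookup (coeff f n) g = Poly_Mapping.lookup (coeff f' n) g"
    by (simp add: lookup_minus)
qed

lemma ev1_gs_term: "ev1 g d l (gs_term P h) = (if g = h then pe P d l else 0)"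
  unfolding gs_term_def
  by (induction P) (simp_all add: map_poly_pCons pe_def lookup_single when_def)

lemma ev1_super_sign:
  "ev1 g d l (super_sign i j f) = (if i = 1 \<and> j = 1 then - 1 else 1) * ev1 g d l f"
  by (simp add: super_sign_def)

text \<open>Under evaluation the operator substituted for \<lambda> acts as multiplication by the
  number \<open>- l - d\<close>.\<close>

lemma ev1_skew_subst:
  "ev1 g d l (skew_subst (gs_scale [:0, 1:]) f) = ev1 g d (- l - d) f"
  unfolding skew_subst_def
  by (subst additive_subst_op[where t = "- l - d"]) (simp_all add: ev1_def[of g d "- l - d"] algebra_simps)

lemma ev1_poly_op:
  assumes "\<And>f. ev1 g d l (X f) = t * ev1 g d l f"
  shows "ev1 g d l (poly_op q X f) = poly q t * ev1 g d l f"
proof -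
  have "ev1 g d l ((X ^^ n) f) = t ^ n * ev1 g d l f" for n
    by (induction n) (simp_all add: assms)
  then show ?thesis
    by (simp add: poly_op_def ev1_sum poly_altdef sum_distrib_right mult.assoc)
qed

lemma ev2_add [simp]: "ev2 g d l m (F + F') = ev2 g d l m F + ev2 g d l m F'"
  by (simp add: ev2_def map_poly_add)

lemma ev2_0 [simp]: "ev2 g d l m 0 = 0"
  by (simp add: ev2_def)

lemma ev2_pCons [simp]: "ev2 g d l m (pCons f F) = ev1 g d l f + m * ev2 g d l m F"
  by (simp add: ev2_def map_poly_pCons)

lemma ev2_uminus [simp]: "ev2 g d l m (- F) = - ev2 g d l m F"
  by (rule additive_uminus) simp

lemma ev2_mult_mu [simp]: "ev2 g d l m (mult_mu F) = m * ev2 g d l m F"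
  by (simp add: mult_mu_def)

lemma ev2_mult_lam [simp]: "ev2 g d l m (mult_lam F) = l * ev2 g d l m F"
  unfolding mult_lam_def
  by (induction F) (simp_all add: map_poly_pCons algebra_simps)

lemma ev2_super_sign:
  "ev2 g d l m (super_sign i j f) = (if i = 1 \<and> j = 1 then - 1 else 1) * ev2 g d l m f"
  by (simp add: super_sign_def)

lemma ev2_subst_const:
  assumes "\<And>F. ev2 g d l m (X F) = t * ev2 g d l m F"
  shows "ev2 g d l m (subst_op X (\<lambda>s. [:[:s:]:]) f) = ev1 g d t f"
  by (subst additive_subst_op[where t = t]) (simp_all add: assms ev1_def[of g d t])

lemma ev2_eqI:
  assumes "\<And>g d l m. ev2 g d l m F = ev2 g d l m F'"
  shows "F = F'"
proof (rule poly_eqI, rule ev1_eqI)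
  fix n g d l
  have "map_poly (ev1 g d l) F = map_poly (ev1 g d l) F'"
    using assms by (simp add: ev2_def poly_eq_poly_eq_iff[symmetric] fun_eq_iff)
  then have "coeff (map_poly (ev1 g d l) F) n = coeff (map_poly (ev1 g d l) F') n"
    by simp
  then show "ev1 g d l (coeff F n) = ev1 g d l (coeff F' n)"
    by (simp add: coeff_map_poly)
qed


section \<open>Sesquilinear extension of a bracket on generators\<close>

definition sesq_ext :: "(gen \<Rightarrow> gen \<Rightarrow> gs poly) \<Rightarrow> gs \<Rightarrow> gs \<Rightarrow> gs poly" where
  "sesq_ext B x y = (\<Sum>g\<in>Poly_Mapping.keys x. \<Sum>h\<in>Poly_Mapping.keys y.
     poly_op (Poly_Mapping.lookup x g) (\<lambda>f. - pCons 0 f)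
       (poly_op (Poly_Mapping.lookup y h) (\<lambda>f. map_poly (gs_scale [:0, 1:]) f + pCons 0 f)
         (B g h)))"

text \<open>Makes the bracket on generators a parameter \<open>B\<close>, so that the reduction to
  generators is independent of the concrete structure polynomials.\<close>

lemma gs_br_eq_sesq_ext:
  "gs_br p \<alpha> \<beta> \<gamma> \<alpha>' \<beta>' \<gamma>' phi vphi = sesq_ext (gs_gen_br p \<alpha> \<beta> \<gamma> \<alpha>' \<beta>' \<gamma>' phi vphi)"
  by (intro ext) (simp add: gs_br_def sesq_ext_def)

lemma ev1_sesq_ext_keys:
  "ev1 g d l (sesq_ext B x y) =
     (\<Sum>a\<in>Poly_Mapping.keys x. \<Sum>b\<in>Poly_Mapping.keys y.
        poly (Poly_Mapping.lookup x a) (- l) * poly (Poly_Mapping.lookup y b) (d + l)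
          * ev1 g d l (B a b))"
  unfolding sesq_ext_def
  by (simp add: ev1_sum ev1_poly_op[where t = "- l"] ev1_poly_op[where t = "d + l"]
      algebra_simps)

text \<open>Coefficients outside the keys are zero. The freedom in \<open>X\<close> and
  \<open>Y\<close> allows brackets of different elements to be summed over a common index
  set.\<close>

lemma ev1_sesq_ext:
  assumes "finite X" "Poly_Mapping.keys x \<subseteq> X" "finite Y" "Poly_Mapping.keys y \<subseteq> Y"
  shows "ev1 g d l (sesq_ext B x y) =
     (\<Sum>a\<in>X. \<Sum>b\<in>Y.
        poly (Poly_Mapping.lookup x a) (- l) * poly (Poly_Mapping.lookup y b) (d + l)
          * ev1 g d l (B a b))"
proof -
  have inner: "(\<Sum>b\<in>Poly_Mapping.keys y. q * poly (Poly_Mapping.lookup y b) (d + l) * r b)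
      = (\<Sum>b\<in>Y. q * poly (Poly_Mapping.lookup y b) (d + l) * r b)" for q and r :: "gen \<Rightarrow> complex"
    by (rule sum.mono_neutral_left) (use assms in \<open>auto simp: in_keys_iff\<close>)
  show ?thesis
    unfolding ev1_sesq_ext_keys inner
    by (rule sum.mono_neutral_left) (use assms in \<open>auto simp: in_keys_iff\<close>)
qed

lemma sesq_ext_0 [simp]: "sesq_ext B 0 y = 0" "sesq_ext B x 0 = 0"
  by (simp_all add: sesq_ext_def)

lemma ev1_sesq_ext_add_left:
  "ev1 g d l (sesq_ext B (x + x') y) = ev1 g d l (sesq_ext B x y) + ev1 g d l (sesq_ext B x' y)"
proof -
  \<comment> \<open>Cancellation can make the keys of \<open>x + x'\<close> smaller than this union,
    so all three brackets are expanded over the union.\<close>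
  let ?X = "Poly_Mapping.keys x \<union> Poly_Mapping.keys x'"
  have "ev1 g d l (sesq_ext B z y) = (\<Sum>a\<in>?X. \<Sum>b\<in>Poly_Mapping.keys y.
        poly (Poly_Mapping.lookup z a) (- l) * poly (Poly_Mapping.lookup y b) (d + l)
          * ev1 g d l (B a b))" if "Poly_Mapping.keys z \<subseteq> ?X" for z
    using that by (intro ev1_sesq_ext) simp_all
  from this[of x] this[of x'] this[OF keys_add] show ?thesis
    by (simp add: lookup_add distrib_right sum.distrib)
qed

lemma ev1_sesq_ext_add_right:
  "ev1 g d l (sesq_ext B x (y + y')) = ev1 g d l (sesq_ext B x y) + ev1 g d l (sesq_ext B x y')"
proof -
  let ?Y = "Poly_Mapping.keys y \<union> Poly_Mapping.keys y'"
  have "ev1 g d l (sesq_ext B x z) = (\<Sum>a\<in>Poly_Mapping.keys x. \<Sum>b\<in>?Y.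
        poly (Poly_Mapping.lookup x a) (- l) * poly (Poly_Mapping.lookup z b) (d + l)
          * ev1 g d l (B a b))" if "Poly_Mapping.keys z \<subseteq> ?Y" for z
    using that by (intro ev1_sesq_ext) simp_all
  from this[of y] this[of y'] this[OF keys_add] show ?thesis
    by (simp add: lookup_add distrib_right distrib_left sum.distrib)
qed

lemma keys_gs_scale: "Poly_Mapping.keys (gs_scale q x) \<subseteq> Poly_Mapping.keys x"
  by (auto simp: in_keys_iff)

lemma ev1_sesq_ext_scale_left:
  "ev1 g d l (sesq_ext B (gs_scale q x) y) = poly q (- l) * ev1 g d l (sesq_ext B x y)"
  by (subst ev1_sesq_ext[OF finite_keys keys_gs_scale finite_keys order_refl])
     (simp add: ev1_sesq_ext_keys sum_distrib_left mult_ac)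

lemma ev1_sesq_ext_scale_right:
  "ev1 g d l (sesq_ext B x (gs_scale q y)) = poly q (d + l) * ev1 g d l (sesq_ext B x y)"
  by (subst ev1_sesq_ext[OF finite_keys order_refl finite_keys keys_gs_scale])
     (simp add: ev1_sesq_ext_keys sum_distrib_left mult_ac)

lemma module_gs_scale: "module gs_scale"
  by unfold_locales (rule poly_mapping_eqI, simp add: lookup_add algebra_simps)+

lemma mem_gs_grade_iff:
  "x \<in> gs_grade i \<longleftrightarrow> (\<forall>g. gen_parity g \<noteq> i \<longrightarrow> Poly_Mapping.lookup x g = 0)"
  by (auto simp: gs_grade_def in_keys_iff)

text \<open>With weights \<open>K\<close> coming from an outer bracket, this evaluates a nested
  bracket as a combination of coordinates of the inner one.\<close>

lemma poly_map_poly_lookup_sum: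
  "poly (map_poly (\<lambda>s. \<Sum>h\<in>Z. poly (Poly_Mapping.lookup s h) d * K h) f) m =
     (\<Sum>h\<in>Z. ev1 h d m f * K h)"
  by (induction f)
     (simp_all add: map_poly_pCons algebra_simps sum.distrib sum_distrib_left)

lemma map_poly_cong_coeff:
  assumes "\<And>n. e (coeff f n) = e' (coeff f n)" "e 0 = 0" "e' 0 = 0"
  shows "map_poly e f = map_poly e' f"
  by (rule poly_eqI) (simp add: coeff_map_poly assms)

section \<open>Reduction of the axioms to generators\<close>

locale gen_bracket =
  fixes B :: "gen \<Rightarrow> gen \<Rightarrow> gs poly" and T :: "gen \<Rightarrow> gen \<Rightarrow> gen set"
  assumes finite_T: "finite (T a b)"
    and ev1_outside_T: "g \<notin> T a b \<Longrightarrow> ev1 g d l (B a b) = 0"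
begin

text \<open>The bound does not depend on \<open>n\<close>, so one finite index set serves all
  coefficients of an inner bracket.\<close>

lemma keys_coeff_sesq_ext:
  "Poly_Mapping.keys (coeff (sesq_ext B x y) n) \<subseteq>
     (\<Union>a\<in>Poly_Mapping.keys x. \<Union>b\<in>Poly_Mapping.keys y. T a b)" (is "_ \<subseteq> ?Z")
proof
  fix h assume h: "h \<in> Poly_Mapping.keys (coeff (sesq_ext B x y) n)"
  show "h \<in> ?Z"
  proof (rule ccontr)
    assume "h \<notin> ?Z"
    then have "ev1 h d l (sesq_ext B x y) = 0" for d l
      by (auto simp: ev1_sesq_ext_keys ev1_outside_T intro!: sum.neutral)
    then show False
      using h lookup_coeff_eq_0I by (simp add: in_keys_iff)
  qed
qed

lemma sum_ev1_sesq_ext: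
  fixes K :: "gen \<Rightarrow> complex"
  defines "Z x y \<equiv> \<Union>a\<in>Poly_Mapping.keys x. \<Union>b\<in>Poly_Mapping.keys y. T a b"
  shows "(\<Sum>h\<in>Z x y. ev1 h d l (sesq_ext B x y) * K h) =
     (\<Sum>a\<in>Poly_Mapping.keys x. \<Sum>b\<in>Poly_Mapping.keys y.
        poly (Poly_Mapping.lookup x a) (- l) * poly (Poly_Mapping.lookup y b) (d + l)
          * (\<Sum>h\<in>T a b. ev1 h d l (B a b) * K h))"
proof -
  have fin: "finite (Z x y)"
    by (simp add: Z_def finite_T)
  have "(\<Sum>h\<in>Z x y. ev1 h d l (sesq_ext B x y) * K h) =
     (\<Sum>a\<in>Poly_Mapping.keys x. \<Sum>b\<in>Poly_Mapping.keys y.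
        poly (Poly_Mapping.lookup x a) (- l) * poly (Poly_Mapping.lookup y b) (d + l)
          * (\<Sum>h\<in>Z x y. ev1 h d l (B a b) * K h))"
    unfolding ev1_sesq_ext_keys sum_distrib_left sum_distrib_right
    by (subst sum.swap, rule sum.cong[OF refl], subst sum.swap)
       (simp add: mult.assoc)
  also have "\<dots> = (\<Sum>a\<in>Poly_Mapping.keys x. \<Sum>b\<in>Poly_Mapping.keys y.
        poly (Poly_Mapping.lookup x a) (- l) * poly (Poly_Mapping.lookup y b) (d + l)
          * (\<Sum>h\<in>T a b. ev1 h d l (B a b) * K h))"
  proof -
    have "(\<Sum>h\<in>Z x y. ev1 h d l (B a b) * K h) = (\<Sum>h\<in>T a b. ev1 h d l (B a b) * K h)"
      if "a \<in> Poly_Mapping.keys x" "b \<in> Poly_Mapping.keys y" for a b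
      using that by (intro sum.mono_neutral_right fin) (auto simp: Z_def ev1_outside_T)
    then show ?thesis
      by simp
  qed
  finally show ?thesis .
qed

text \<open>An element in the right slot of the outer bracket is evaluated at \<partial> =
  \<open>d + l\<close>. Hence the inner bracket is taken there, and the factor of \<open>z\<close>
  is evaluated at \<open>(d + l) + m\<close>.\<close>

lemma ev1_nested_right:
  "poly (map_poly (\<lambda>s. ev1 g d l (sesq_ext B x s)) (sesq_ext B y z)) m =
     (\<Sum>a\<in>Poly_Mapping.keys x. \<Sum>b\<in>Poly_Mapping.keys y. \<Sum>c\<in>Poly_Mapping.keys z.
        poly (Poly_Mapping.lookup x a) (- l) * poly (Poly_Mapping.lookup y b) (- m)
          * poly (Poly_Mapping.lookup z c) (d + l + m)
          * (\<Sum>h\<in>T b c. ev1 h (d + l) m (B b c) * ev1 g d l (B a h)))"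
proof -
  let ?Z = "\<Union>a\<in>Poly_Mapping.keys y. \<Union>b\<in>Poly_Mapping.keys z. T a b"
  let ?K = "\<lambda>h. \<Sum>a\<in>Poly_Mapping.keys x. poly (Poly_Mapping.lookup x a) (- l) * ev1 g d l (B a h)"
  have fin: "finite ?Z"
    by (simp add: finite_T)
  have "map_poly (\<lambda>s. ev1 g d l (sesq_ext B x s)) (sesq_ext B y z) =
     map_poly (\<lambda>s. \<Sum>h\<in>?Z. poly (Poly_Mapping.lookup s h) (d + l) * ?K h) (sesq_ext B y z)"
  proof (rule map_poly_cong_coeff)
    fix n
    show "ev1 g d l (sesq_ext B x (coeff (sesq_ext B y z) n)) =
       (\<Sum>h\<in>?Z. poly (Poly_Mapping.lookup (coeff (sesq_ext B y z) n) h) (d + l) * ?K h)"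
      unfolding ev1_sesq_ext[OF finite_keys order_refl fin keys_coeff_sesq_ext] sum_distrib_left
      by (subst sum.swap) (simp add: mult_ac)
  qed (simp_all add: ev1_sesq_ext_keys)
  then have "poly (map_poly (\<lambda>s. ev1 g d l (sesq_ext B x s)) (sesq_ext B y z)) m =
     (\<Sum>h\<in>?Z. ev1 h (d + l) m (sesq_ext B y z) * ?K h)"
    by (simp only: poly_map_poly_lookup_sum)
  also have "\<dots> = (\<Sum>a\<in>Poly_Mapping.keys x. poly (Poly_Mapping.lookup x a) (- l) *
     (\<Sum>h\<in>?Z. ev1 h (d + l) m (sesq_ext B y z) * ev1 g d l (B a h)))"
    unfolding sum_distrib_left by (subst sum.swap) (simp add: mult_ac)
  finally show ?thesis
    unfolding sum_ev1_sesq_ext by (simp add: sum_distrib_left mult_ac)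
qed

text \<open>An element in the left slot of the outer bracket, whose parameter is
  \<open>l + m\<close>, is evaluated at \<partial> = \<open>- l - m\<close>. The factor of
  \<open>y\<close> in the inner bracket is then evaluated at \<open>(- l - m) + l = - m\<close>, as
  in the right-nested case.\<close>

lemma ev1_nested_left:
  "poly (map_poly (\<lambda>s. ev1 g d (l + m) (sesq_ext B s z)) (sesq_ext B x y)) l =
     (\<Sum>a\<in>Poly_Mapping.keys x. \<Sum>b\<in>Poly_Mapping.keys y. \<Sum>c\<in>Poly_Mapping.keys z.
        poly (Poly_Mapping.lookup x a) (- l) * poly (Poly_Mapping.lookup y b) (- m)
          * poly (Poly_Mapping.lookup z c) (d + l + m)
          * (\<Sum>h\<in>T a b. ev1 h (- l - m) l (B a b) * ev1 g d (l + m) (B h c)))"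
proof -
  let ?Z = "\<Union>a\<in>Poly_Mapping.keys x. \<Union>b\<in>Poly_Mapping.keys y. T a b"
  let ?K = "\<lambda>h. \<Sum>c\<in>Poly_Mapping.keys z. poly (Poly_Mapping.lookup z c) (d + l + m)
              * ev1 g d (l + m) (B h c)"
  have fin: "finite ?Z"
    by (simp add: finite_T)
  have "map_poly (\<lambda>s. ev1 g d (l + m) (sesq_ext B s z)) (sesq_ext B x y) =
     map_poly (\<lambda>s. \<Sum>h\<in>?Z. poly (Poly_Mapping.lookup s h) (- l - m) * ?K h) (sesq_ext B x y)"
  proof (rule map_poly_cong_coeff)
    fix n
    show "ev1 g d (l + m) (sesq_ext B (coeff (sesq_ext B x y) n) z) =
       (\<Sum>h\<in>?Z. poly (Poly_Mapping.lookup (coeff (sesq_ext B x y) n) h) (- l - m) * ?K h)"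
      unfolding ev1_sesq_ext[OF fin keys_coeff_sesq_ext finite_keys order_refl] sum_distrib_left
      by (simp add: algebra_simps)
  qed (simp_all add: ev1_sesq_ext_keys)
  then have "poly (map_poly (\<lambda>s. ev1 g d (l + m) (sesq_ext B s z)) (sesq_ext B x y)) l =
     (\<Sum>h\<in>?Z. ev1 h (- l - m) l (sesq_ext B x y) * ?K h)"
    by (simp only: poly_map_poly_lookup_sum)
  also have "\<dots> = (\<Sum>a\<in>Poly_Mapping.keys x. \<Sum>b\<in>Poly_Mapping.keys y.
        poly (Poly_Mapping.lookup x a) (- l) * poly (Poly_Mapping.lookup y b) (- m)
          * (\<Sum>h\<in>T a b. ev1 h (- l - m) l (B a b) * ?K h))"
    unfolding sum_ev1_sesq_ext by simp
  also have "\<dots> = (\<Sum>a\<in>Poly_Mapping.keys x. \<Sum>b\<in>Poly_Mapping.keys y.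
      \<Sum>c\<in>Poly_Mapping.keys z.
        poly (Poly_Mapping.lookup x a) (- l) * poly (Poly_Mapping.lookup y b) (- m)
          * poly (Poly_Mapping.lookup z c) (d + l + m)
          * (\<Sum>h\<in>T a b. ev1 h (- l - m) l (B a b) * ev1 g d (l + m) (B h c)))"
  proof (intro sum.cong refl)
    fix a b
    have "(\<Sum>h\<in>T a b. ev1 h (- l - m) l (B a b) * ?K h) =
      (\<Sum>c\<in>Poly_Mapping.keys z. poly (Poly_Mapping.lookup z c) (d + l + m)
          * (\<Sum>h\<in>T a b. ev1 h (- l - m) l (B a b) * ev1 g d (l + m) (B h c)))"
      unfolding sum_distrib_left by (subst sum.swap) (simp add: mult_ac)
    then show "poly (Poly_Mapping.lookup x a) (- l) * poly (Poly_Mapping.lookup y b) (- m)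
          * (\<Sum>h\<in>T a b. ev1 h (- l - m) l (B a b) * ?K h) =
      (\<Sum>c\<in>Poly_Mapping.keys z.
        poly (Poly_Mapping.lookup x a) (- l) * poly (Poly_Mapping.lookup y b) (- m)
          * poly (Poly_Mapping.lookup z c) (d + l + m)
          * (\<Sum>h\<in>T a b. ev1 h (- l - m) l (B a b) * ev1 g d (l + m) (B h c)))"
      by (simp add: sum_distrib_left mult_ac)
  qed
  finally show ?thesis .
qed

lemma ev2_jacobi_right:
  "ev2 g d l m (subst_op mult_mu
      (\<lambda>s. subst_op mult_lam (\<lambda>s. [:[:s:]:]) (sesq_ext B x s)) (sesq_ext B y z)) =
   (\<Sum>a\<in>Poly_Mapping.keys x. \<Sum>b\<in>Poly_Mapping.keys y. \<Sum>c\<in>Poly_Mapping.keys z.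
        poly (Poly_Mapping.lookup x a) (- l) * poly (Poly_Mapping.lookup y b) (- m)
          * poly (Poly_Mapping.lookup z c) (d + l + m)
          * (\<Sum>h\<in>T b c. ev1 h (d + l) m (B b c) * ev1 g d l (B a h)))"
  by (subst additive_subst_op[where t = m and E = "ev2 g d l m"])
     (simp_all add: ev2_subst_const[where t = l] ev1_nested_right)

lemma ev2_jacobi_left:
  "ev2 g d l m (subst_op mult_lam
      (\<lambda>s. subst_op (\<lambda>f. mult_lam f + mult_mu f) (\<lambda>s. [:[:s:]:]) (sesq_ext B s z))
      (sesq_ext B x y)) =
   (\<Sum>a\<in>Poly_Mapping.keys x. \<Sum>b\<in>Poly_Mapping.keys y. \<Sum>c\<in>Poly_Mapping.keys z.
        poly (Poly_Mapping.lookup x a) (- l) * poly (Poly_Mapping.lookup y b) (- m)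
          * poly (Poly_Mapping.lookup z c) (d + l + m)
          * (\<Sum>h\<in>T a b. ev1 h (- l - m) l (B a b) * ev1 g d (l + m) (B h c)))"
  by (subst additive_subst_op[where t = l and E = "ev2 g d l m"])
     (simp_all add: ev2_subst_const[where t = "l + m"] ev1_nested_left
        distrib_right)

lemma ev2_jacobi_swapped:
  "ev2 g d l m (subst_op mult_lam
      (\<lambda>s. subst_op mult_mu (\<lambda>s. [:[:s:]:]) (sesq_ext B y s)) (sesq_ext B x z)) =
   (\<Sum>a\<in>Poly_Mapping.keys x. \<Sum>b\<in>Poly_Mapping.keys y. \<Sum>c\<in>Poly_Mapping.keys z.
        poly (Poly_Mapping.lookup x a) (- l) * poly (Poly_Mapping.lookup y b) (- m)
          * poly (Poly_Mapping.lookup z c) (d + l + m)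
          * (\<Sum>h\<in>T a c. ev1 h (d + m) l (B a c) * ev1 g d m (B b h)))"
proof -
  have "ev2 g d l m (subst_op mult_lam
      (\<lambda>s. subst_op mult_mu (\<lambda>s. [:[:s:]:]) (sesq_ext B y s)) (sesq_ext B x z)) =
    poly (map_poly (\<lambda>s. ev1 g d m (sesq_ext B y s)) (sesq_ext B x z)) l"
    by (subst additive_subst_op[where t = l and E = "ev2 g d l m"])
       (simp_all add: ev2_subst_const[where t = m])
  then show ?thesis
    \<comment> \<open>This is the right-nested formula with \<open>x\<close>, \<open>y\<close> and
      \<open>l\<close>, \<open>m\<close> exchanged; swapping the two outer sums restores the common
      order.\<close>
    unfolding ev1_nested_right by (subst (asm) sum.swap) (simp add: ac_simps)
qed

text \<open>On generators with coefficient 1 the weights are all 1 and each triple sum has a single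
  term.\<close>

lemma jacobi_on_gens:
  assumes "lie_conformal_superalgebra gs_scale gs_grade (sesq_ext B)"
  shows "(\<Sum>h\<in>T b c. ev1 h (d + l) m (B b c) * ev1 g d l (B a h)) =
     (\<Sum>h\<in>T a b. ev1 h (- l - m) l (B a b) * ev1 g d (l + m) (B h c)) +
     (if gen_parity a = 1 \<and> gen_parity b = 1 then - 1 else 1) *
     (\<Sum>h\<in>T a c. ev1 h (d + m) l (B a c) * ev1 g d m (B b h))"
proof -
  have "Poly_Mapping.single x 1 \<in> gs_grade (gen_parity x)" for x
    by (simp add: gs_grade_def)
  from arg_cong[where f = "ev2 g d l m",
      OF lie_conformal_superalgebra.br_jacobi[OF assms this this, of a b "Poly_Mapping.single c 1"]]
  show ?thesis
    unfolding ev2_add ev2_super_sign ev2_jacobi_right ev2_jacobi_left ev2_jacobi_swapped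
    by (simp add: lookup_single)
qed

text \<open>All generators in the support of a homogeneous element have its parity, so the sign is
  the same in every term and the skew-symmetry and Jacobi axioms can be checked term by
  term.\<close>

lemma lie_conformal_superalgebra_sesq_ext:
  assumes parity: "\<And>a b g d l. ev1 g d l (B a b) \<noteq> 0 \<Longrightarrow> gen_parity g = gen_parity a + gen_parity b"
    and skew: "\<And>a b g d l. ev1 g d l (B a b) =
      - (if gen_parity a = 1 \<and> gen_parity b = 1 then - 1 else 1) * ev1 g d (- l - d) (B b a)"
    and jacobi: "\<And>a b c g d l m.
      (\<Sum>h\<in>T b c. ev1 h (d + l) m (B b c) * ev1 g d l (B a h)) =
      (\<Sum>h\<in>T a b. ev1 h (- l - m) l (B a b) * ev1 g d (l + m) (B h c)) +
      (if gen_parity a = 1 \<and> gen_parity b = 1 then - 1 else 1) *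
      (\<Sum>h\<in>T a c. ev1 h (d + m) l (B a c) * ev1 g d m (B b h))"
  shows "lie_conformal_superalgebra gs_scale gs_grade (sesq_ext B)"
proof (intro lie_conformal_superalgebra.intro lie_conformal_superalgebra_axioms.intro)
  show "module gs_scale"
    by (rule module_gs_scale)
  show "module.subspace gs_scale (gs_grade i)" for i
    by (simp add: module.subspace_def[OF module_gs_scale] mem_gs_grade_iff lookup_add)
  show "gs_grade 0 \<inter> gs_grade 1 = {0}"
  proof -
    have "x = 0" if "x \<in> gs_grade 0" "x \<in> gs_grade 1" for x
    proof (rule poly_mapping_eqI)
      fix g
      have "gen_parity g \<noteq> 0 \<or> gen_parity g \<noteq> 1"
        by (cases g) simp_all
      with that show "Poly_Mapping.lookup x g = Poly_Mapping.lookup 0 g"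
        unfolding mem_gs_grade_iff lookup_zero by blast
    qed
    then show ?thesis
      by (auto simp: mem_gs_grade_iff)
  qed
  show "\<exists>a\<in>gs_grade 0. \<exists>b\<in>gs_grade 1. x = a + b" for x
  proof -
    define r where "r i = Abs_poly_mapping
      (\<lambda>g. if gen_parity g = i then Poly_Mapping.lookup x g else 0)" for i
    have r: "Poly_Mapping.lookup (r i) g =
        (if gen_parity g = i then Poly_Mapping.lookup x g else 0)" for i g
    proof -
      have "finite {g. (if gen_parity g = i then Poly_Mapping.lookup x g else 0) \<noteq> 0}"
        by (rule finite_subset[OF _ finite_keys[of x]]) (auto simp: in_keys_iff)
      then show ?thesis
        by (simp add: r_def)
    qed
    have "x = r 0 + r 1"
      by (rule poly_mapping_eqI) (auto simp: lookup_add r)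
    moreover have "r i \<in> gs_grade i" for i
      by (simp add: mem_gs_grade_iff r)
    ultimately show ?thesis
      by blast
  qed
  show "sesq_ext B (a + a') b = sesq_ext B a b + sesq_ext B a' b" for a a' b
    by (rule ev1_eqI) (simp add: ev1_sesq_ext_add_left)
  show "sesq_ext B a (b + b') = sesq_ext B a b + sesq_ext B a b'" for a b b'
    by (rule ev1_eqI) (simp add: ev1_sesq_ext_add_right)
  show "sesq_ext B (gs_scale [:c:] a) b = map_poly (gs_scale [:c:]) (sesq_ext B a b)" for c a b
    by (rule ev1_eqI) (simp add: ev1_sesq_ext_scale_left)
  show "sesq_ext B a (gs_scale [:c:] b) = map_poly (gs_scale [:c:]) (sesq_ext B a b)" for c a b
    by (rule ev1_eqI) (simp add: ev1_sesq_ext_scale_right)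
  show "sesq_ext B (gs_scale [:0, 1:] a) b = - pCons 0 (sesq_ext B a b)" for a b
    by (rule ev1_eqI) (simp add: ev1_sesq_ext_scale_left)
  show "sesq_ext B a (gs_scale [:0, 1:] b) =
      map_poly (gs_scale [:0, 1:]) (sesq_ext B a b) + pCons 0 (sesq_ext B a b)" for a b
    by (rule ev1_eqI) (simp add: ev1_sesq_ext_scale_right algebra_simps)
  show "coeff (sesq_ext B a b) n \<in> gs_grade (i + j)"
    if a: "a \<in> gs_grade i" and b: "b \<in> gs_grade j" for i j a b n
    unfolding mem_gs_grade_iff
  proof (intro allI impI lookup_coeff_eq_0I)
    fix g d l assume "gen_parity g \<noteq> i + j"
    then have "ev1 g d l (B x y) = 0" if "x \<in> Poly_Mapping.keys a" "y \<in> Poly_Mapping.keys b" for x y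
      using that a b parity[of g d l x y] by (auto simp: gs_grade_def)
    then show "ev1 g d l (sesq_ext B a b) = 0"
      by (simp add: ev1_sesq_ext_keys)
  qed
  show "sesq_ext B a b = - super_sign i j (skew_subst (gs_scale [:0, 1:]) (sesq_ext B b a))"
    if a: "a \<in> gs_grade i" and b: "b \<in> gs_grade j" for i j a b
  proof (rule ev1_eqI)
    fix g d l
    have "ev1 g d l (sesq_ext B a b) =
      (\<Sum>x\<in>Poly_Mapping.keys a. \<Sum>y\<in>Poly_Mapping.keys b.
        poly (Poly_Mapping.lookup a x) (- l) * poly (Poly_Mapping.lookup b y) (d + l)
          * (- (if i = 1 \<and> j = 1 then - 1 else 1) * ev1 g d (- l - d) (B y x)))"
      unfolding ev1_sesq_ext_keys
      by (intro sum.cong refl arg_cong2[where f = "(*)"], subst skew)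
         (use a b in \<open>auto simp: gs_grade_def\<close>)
    also have "\<dots> = - (if i = 1 \<and> j = 1 then - 1 else 1) * ev1 g d (- l - d) (sesq_ext B b a)"
      unfolding ev1_sesq_ext_keys sum_distrib_left
      by (subst sum.swap) (simp add: mult_ac add.commute)
    finally show "ev1 g d l (sesq_ext B a b) =
        ev1 g d l (- super_sign i j (skew_subst (gs_scale [:0, 1:]) (sesq_ext B b a)))"
      by (simp add: ev1_super_sign ev1_skew_subst)
  qed
  show "subst_op mult_mu (\<lambda>d. subst_op mult_lam (\<lambda>s. [:[:s:]:]) (sesq_ext B a d)) (sesq_ext B b c) =
     subst_op mult_lam
       (\<lambda>d. subst_op (\<lambda>f. mult_lam f + mult_mu f) (\<lambda>s. [:[:s:]:]) (sesq_ext B d c)) (sesq_ext B a b) +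
     super_sign i j
       (subst_op mult_lam (\<lambda>d. subst_op mult_mu (\<lambda>s. [:[:s:]:]) (sesq_ext B b d)) (sesq_ext B a c))"
    if a: "a \<in> gs_grade i" and b: "b \<in> gs_grade j" for i j a b c
  \<comment> \<open>All three Jacobi terms are sums over the same triples of generators with the
    same weight; what remains is the identity on each triple.\<close>
  proof (rule ev2_eqI,
      unfold ev2_add ev2_super_sign ev2_jacobi_right ev2_jacobi_left ev2_jacobi_swapped
        sum_distrib_left[where r = "if _ then _ else _"] sum.distrib[symmetric],
      intro sum.cong refl, goal_cases)
    case (1 g d l m x y z)
    then have "gen_parity x = i" "gen_parity y = j"
      using a b by (auto simp: gs_grade_def)
    then show ?case
      by (subst jacobi) (simp add: algebra_simps)
  qed
qed

end

section \<open>Structure constants of the given brackets\<close>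

fun gen_index :: "gen \<Rightarrow> nat" where
  "gen_index (L i) = i"
| "gen_index (W i) = i"
| "gen_index (G i) = i"
| "gen_index (H i) = i"

text \<open>Indices add under the bracket, so the set at the sum of two indices serves as the bound
  \<open>T\<close> and every inner sum has four terms.\<close>

definition gens_at :: "nat \<Rightarrow> gen set" where
  "gens_at n = {L n, W n, G n, H n}"

text \<open>
  \<open>gs_const p U V a b g \<partial> \<lambda>\<close> is the coefficient of \<open>g\<close> in \<open>[a \<^sub>\<lambda> b]\<close>, where \<open>U\<close> and \<open>V\<close> stand for the
  values of \<open>phi\<close> and \<open>vphi\<close>.
\<close>

fun gs_const :: "complex \<Rightarrow> (nat \<Rightarrow> nat \<Rightarrow> complex \<Rightarrow> complex \<Rightarrow> complex) \<Rightarrow>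
    (nat \<Rightarrow> nat \<Rightarrow> complex \<Rightarrow> complex \<Rightarrow> complex) \<Rightarrow>
    gen \<Rightarrow> gen \<Rightarrow> gen \<Rightarrow> complex \<Rightarrow> complex \<Rightarrow> complex" where
  "gs_const p U V (L i) (L j) g d l =
     (if g = L (i + j) then (of_nat i + p) * d + (of_nat i + of_nat j + 2 * p) * l else 0)"
| "gs_const p U V (L i) (W j) g d l =
     (if g = W (i + j) then (of_nat i + p) * d + (of_nat i + of_nat j + p) * l else 0)"
| "gs_const p U V (W i) (L j) g d l =
     (if g = W (i + j) then of_nat i * d + (of_nat i + of_nat j + p) * l else 0)"
| "gs_const p U V (L i) (G j) g d l =
     (if g = G (i + j) then (of_nat i + p) * d + (of_nat i + of_nat j + 2 * p) * l else 0)"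
| "gs_const p U V (G i) (L j) g d l =
     (if g = G (i + j) then (of_nat i + p) * d + (of_nat i + of_nat j + 2 * p) * l else 0)"
| "gs_const p U V (L i) (H j) g d l =
     (if g = H (i + j) then (of_nat i + p) * d + (of_nat i + of_nat j + p) * l else 0)"
| "gs_const p U V (H i) (L j) g d l =
     (if g = H (i + j) then of_nat i * d + (of_nat i + of_nat j + p) * l else 0)"
| "gs_const p U V (W i) (G j) g d l = (if g = G (i + j) then 1 else 0)"
| "gs_const p U V (G i) (W j) g d l = (if g = G (i + j) then - 1 else 0)"
| "gs_const p U V (W i) (H j) g d l = (if g = H (i + j) then - 1 else 0)"
| "gs_const p U V (H i) (W j) g d l = (if g = H (i + j) then 1 else 0)"
| "gs_const p U V (G i) (H j) g d l =
     (if g = W (i + j) then U i j d l else if g = L (i + j) then V i j d l else 0)"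
| "gs_const p U V (H i) (G j) g d l =
     (if g = W (i + j) then U j i d (- l - d) else if g = L (i + j) then V j i d (- l - d) else 0)"
| "gs_const p U V _ _ g d l = 0"

lemma pe_simps [simp]:
  "pe (P + Q) d l = pe P d l + pe Q d l"
  "pe (P * Q) d l = pe P d l * pe Q d l"
  "pe (cst c) d l = c"
  "pe del d l = d"
  "pe lam d l = l"
  by (simp_all add: pe_def cst_def del_def lam_def)

text \<open>Pairs left to skew-symmetry are obtained from \<lambda> \<mapsto> -\<lambda> -
  \<partial>. For instance -((j + p)\<partial> + (i + j + p)(-\<lambda> - \<partial>)) = i\<partial>
  + (i + j + p)\<lambda> gives the entry for \<open>W i\<close>, \<open>L j\<close>.\<close>

lemma ev1_gs_gen_br:
  "ev1 g d l (gs_gen_br p (2 * p) 0 1 p 0 (- 1) phi vphi a b) =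
     gs_const p (\<lambda>i j. pe (phi i j)) (\<lambda>i j. pe (vphi i j)) a b g d l"
  by (cases a; cases b)
     (simp_all add: gs_gen_br_def ev1_gs_term ev1_super_sign ev1_skew_subst add.commute algebra_simps)

lemma gs_const_outside:
  "g \<notin> gens_at (gen_index a + gen_index b) \<Longrightarrow> gs_const p U V a b g d l = 0"
  by (cases a; cases b) (simp_all add: gens_at_def)

lemma gs_const_parity:
  "gs_const p U V a b g d l \<noteq> 0 \<Longrightarrow> gen_parity g = gen_parity a + gen_parity b"
  by (cases a; cases b) (simp_all split: if_splits)

lemma gs_const_skew:
  "gs_const p U V a b g d l =
     - (if gen_parity a = 1 \<and> gen_parity b = 1 then - 1 else 1) * gs_const p U V b a g d (- l - d)"
  by (cases a; cases b) (simp_all add: add.commute algebra_simps)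

text \<open>For each of the 64 choices of constructors the claim is a polynomial identity in
  \<open>d\<close>, \<open>l\<close>, \<open>m\<close>, the indices, \<open>p\<close> and \<Delta>.
  The assumed \<open>U\<close> is \<Delta> times the coefficient of the bracket of
  \<open>L i\<close> with \<open>W j\<close>.\<close>

lemma gs_const_jacobi:
  assumes U: "\<And>i j d l. U i j d l =
      \<Delta> * ((of_nat i + p) * d + (of_nat i + of_nat j + p) * l)"
    and V: "\<And>i j d l. V i j d l = \<Delta>"
  shows "(\<Sum>h\<in>gens_at (gen_index b + gen_index c).
        gs_const p U V b c h (d + l) m * gs_const p U V a h g d l) =
     (\<Sum>h\<in>gens_at (gen_index a + gen_index b).
        gs_const p U V a b h (- l - m) l * gs_const p U V h c g d (l + m)) +
     (if gen_parity a = 1 \<and> gen_parity b = 1 then - 1 else 1) *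
     (\<Sum>h\<in>gens_at (gen_index a + gen_index c).
        gs_const p U V a c h (d + m) l * gs_const p U V b h g d m)"
  by (cases a; cases b; cases c) (simp_all add: gens_at_def U V algebra_simps)

section \<open>Two functional equations\<close>

lemma shift_invariant_imp_constant:
  fixes p :: complex and v :: "nat \<Rightarrow> complex \<Rightarrow> complex"
  assumes p: "p \<noteq> 0"
    and eq: "\<And>i n d l. v n (d + l) * ((of_nat i + p) * d + (of_nat i + of_nat n + 2 * p) * l) =
      v (i + n) d * ((of_nat i + p) * d + (of_nat i + of_nat n + 2 * p) * l)"
  shows "v n x = v 0 0"
proof -
  \<comment> \<open>Only i = 0 is used here. If n + 2p is nonzero, taking d = 0 compares
    \<open>v n y\<close> with \<open>v n 0\<close>; otherwise the coefficient of l vanishes and d =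
    1 compares \<open>v n y\<close> with \<open>v n 1\<close>.\<close>
  have const: "v n y = v n 0" for n y
  proof (cases "of_nat n + 2 * p = 0")
    case False
    then show ?thesis
      using eq[of n 0 y 0] by (cases "y = 0") simp_all
  next
    case True
    have "v n y = v n 1" for y
      using eq[of n 1 "y - 1" 0] True p by simp
    then show ?thesis
      by metis
  qed
  have "v 0 0 = v n 0"
  proof (cases "of_nat n + p = 0")
    case False
    then show ?thesis
      using eq[of 0 1 0 n] const[of 0 1] const[of n 1] by simp
  next
    case True
    then have "of_nat n + 2 * p \<noteq> 0"
      using p by (auto simp: add_eq_0_iff)
    then show ?thesis
      using eq[of 0 0 1 n] const[of 0 1] by simp
  qed
  with const show ?thesis
    by metis
qed

lemma twisted_shift_invariant_imp_zero:
  fixes p :: complex and w :: "nat \<Rightarrow> complex \<Rightarrow> complex"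
  assumes p: "p \<noteq> 0"
    and eq: "\<And>i n d l. w n (d + l) * ((of_nat i + p) * d + (of_nat i + of_nat n + p) * l) =
      w (i + n) d * ((of_nat i + p) * d + (of_nat i + of_nat n + 2 * p) * l)"
  shows "w n x = 0"
proof -
  have regular: "w n x = 0" if n: "of_nat n + p \<noteq> 0" for n x
  proof -
    \<comment> \<open>The equation at i = 0, d = 0 forces this common value of \<open>w n\<close> at
      all nonzero arguments.\<close>
    define k where "k = (of_nat n + 2 * p) / (of_nat n + p) * w n 0"
    have k: "w n l = k" if "l \<noteq> 0" for l
    proof -
      have "w n l * (of_nat n + p) = w n 0 * (of_nat n + 2 * p)"
        using eq[of n 0 l 0] that by simp
      then show ?thesis
        using n by (simp add: k_def field_simps)
    qed
    \<comment> \<open>At i = 0, d = l = 1 the two factors differ by p, which forces k = 0.\<close>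
    have "k * (of_nat n + 2 * p) = k * (of_nat n + 3 * p)"
      using eq[of n 1 1 0] k[of 1] k[of 2] by (simp add: algebra_simps)
    then have "k = 0"
      using p by (simp add: algebra_simps)
    have "w n 0 = 0"
    proof (cases "n = 0")
      case True
      then show ?thesis
        using \<open>k = 0\<close> p by (simp add: k_def)
    next
      case False
      then show ?thesis
        \<comment> \<open>Taking d = 1 and l = -1 puts the argument 0 on the left with factor -n,
          while the right side contains \<open>w n 1 = k = 0\<close>.\<close>
        using eq[of n 1 "- 1" 0] k[of 1] \<open>k = 0\<close> by simp
    qed
    with k \<open>k = 0\<close> show ?thesis
      by (cases "x = 0") simp_all
  qed
  show ?thesis
  proof (cases "of_nat n + p = 0")
    case True
    \<comment> \<open>Chosen so that the factor of \<open>w n x\<close> in the equation with i = 1,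
      d = x - l equals 1, given that n + p = 0.\<close>
    define l where "l = ((1 + p) * x - 1) / p"
    have "of_nat (1 + n) + p \<noteq> 0"
      using True by (simp add: add.assoc)
    then have "w (1 + n) (x - l) = 0"
      by (rule regular)
    moreover have "(1 + p) * (x - l) + (1 + of_nat n + p) * l = 1"
    proof -
      have "p * l = (1 + p) * x - 1"
        using p by (simp add: l_def)
      moreover have "1 + of_nat n + p = 1"
        using True by (simp add: add.assoc)
      ultimately show ?thesis
        by (simp add: algebra_simps)
    qed
    ultimately show ?thesis
      using eq[of n "x - l" l 1] by simp
  qed (rule regular)
qed

section \<open>Necessity and the equivalence\<close>

lemma gen_bracket_gs_gen_br:
  "gen_bracket (gs_gen_br p (2 * p) 0 1 p 0 (- 1) phi vphi)
     (\<lambda>a b. gens_at (gen_index a + gen_index b))"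
  by unfold_locales (simp_all add: ev1_gs_gen_br gs_const_outside, simp add: gens_at_def)

lemma structure_constants_necessary:
  fixes p :: complex
  assumes p: "p \<noteq> 0"
    and jac: "\<And>a b c g d l m. (\<Sum>h\<in>gens_at (gen_index b + gen_index c).
        gs_const p U V b c h (d + l) m * gs_const p U V a h g d l) =
     (\<Sum>h\<in>gens_at (gen_index a + gen_index b).
        gs_const p U V a b h (- l - m) l * gs_const p U V h c g d (l + m)) +
     (if gen_parity a = 1 \<and> gen_parity b = 1 then - 1 else 1) *
     (\<Sum>h\<in>gens_at (gen_index a + gen_index c).
        gs_const p U V a c h (d + m) l * gs_const p U V b h g d m)"
  shows "V i j d l = V 0 0 0 0"
    and "U i j d l = V 0 0 0 0 * ((of_nat i + p) * d + (of_nat i + of_nat j + p) * l)"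
proof -
  have WGH_L: "V (i + j) k d (l + m) = V j (i + k) d m" for i j k d l m
    using jac[where a = "W i" and b = "G j" and c = "H k"
        and g = "L (i + j + k)" and d = d and l = l and m = m]
    by (simp add: gens_at_def add_ac)
  have WGH_W: "V j k (d + l) m * (of_nat i * d + (of_nat i + of_nat j + of_nat k + p) * l) =
      U (i + j) k d (l + m) - U j (i + k) d m" for i j k d l m
    using jac[where a = "W i" and b = "G j" and c = "H k"
        and g = "W (i + j + k)" and d = d and l = l and m = m]
    by (simp add: gens_at_def add_ac)
  \<comment> \<open>The factor \<open>(j + p) l - (i + p) m\<close> is the coefficient of the
    bracket of \<open>L i\<close> with \<open>G j\<close> at \<partial> = -l - m.\<close>
  have LGH_L: "V j k (d + l) m * ((of_nat i + p) * d + (of_nat i + of_nat j + of_nat k + 2 * p) * l) =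
      ((of_nat j + p) * l - (of_nat i + p) * m) * V (i + j) k d (l + m) +
      ((of_nat i + p) * (d + m) + (of_nat i + of_nat k + p) * l) * V j (i + k) d m" for i j k d l m
    using jac[where a = "L i" and b = "G j" and c = "H k"
        and g = "L (i + j + k)" and d = d and l = l and m = m]
    by (simp add: gens_at_def algebra_simps)
  have LGH_W: "U j k (d + l) m * ((of_nat i + p) * d + (of_nat i + of_nat j + of_nat k + p) * l) =
      ((of_nat j + p) * l - (of_nat i + p) * m) * U (i + j) k d (l + m) +
      ((of_nat i + p) * (d + m) + (of_nat i + of_nat k + p) * l) * U j (i + k) d m" for i j k d l m
    using jac[where a = "L i" and b = "G j" and c = "H k"
        and g = "W (i + j + k)" and d = d and l = l and m = m]
    by (simp add: gens_at_def algebra_simps)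

  \<comment> \<open>Taking the second generator to be \<open>G 0\<close> and \<mu> = 0 reduces
    \<open>V\<close> to a function of i + j and \<partial>.\<close>
  have V_red: "V i j d l = V 0 (i + j) d 0" for i j d l
    using WGH_L[of i 0 j d l 0] by simp
  have "V 0 n (d + l) 0 * ((of_nat i + p) * d + (of_nat i + of_nat n + 2 * p) * l) =
      V 0 (i + n) d 0 * ((of_nat i + p) * d + (of_nat i + of_nat n + 2 * p) * l)" for i n d l
    using LGH_L[of 0 n d l 0 i] V_red[of i n d l] by (simp add: algebra_simps)
  from shift_invariant_imp_constant[where v = "\<lambda>n d. V 0 n d 0", OF p this]
  have V_const: "V i j d l = V 0 0 0 0" for i j d l
    using V_red by metis
  then show "V i j d l = V 0 0 0 0" .

  define \<Delta> where "\<Delta> = V 0 0 0 0"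
  \<comment> \<open>The deviation of \<open>U\<close> from its asserted value at first index 0 and
    \<lambda> = 0; \<open>U_red\<close> shows that the deviation is the same for all pairs with the
    same index sum and for all \<lambda>.\<close>
  define w where "w n d = U 0 n d 0 - \<Delta> * (p * d)" for n d
  have U_red: "U i j d l = \<Delta> * ((of_nat i + p) * d + (of_nat i + of_nat j + p) * l) + w (i + j) d" for i j d l
    using WGH_W[of 0 j d l 0 i] V_const[of 0 j "d + l" 0]
    by (simp add: \<Delta>_def[symmetric] w_def algebra_simps)
  \<comment> \<open>\<open>LGH_W\<close> is linear in \<open>U\<close> and the asserted part
    satisfies it, so only an equation for \<open>w\<close> remains.\<close>
  have "w n (d + l) * ((of_nat i + p) * d + (of_nat i + of_nat n + p) * l) =
      w (i + n) d * ((of_nat i + p) * d + (of_nat i + of_nat n + 2 * p) * l)" for i n d l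
    using LGH_W[of 0 n d l 0 i] unfolding U_red[of 0] U_red[of i] U_red[of "i + 0"]
    by (simp add: algebra_simps)
  from twisted_shift_invariant_imp_zero[where w = w, OF p this] U_red
  show "U i j d l = V 0 0 0 0 * ((of_nat i + p) * d + (of_nat i + of_nat j + p) * l)"
    by (simp add: \<Delta>_def)
qed

theorem lemma5p1:
  fixes p \<alpha>\<^sub>1 \<beta>\<^sub>1 \<gamma>\<^sub>1 \<alpha>h\<^sub>1 \<beta>h\<^sub>1 \<gamma>h\<^sub>1 :: complex
    and phi vphi :: "nat \<Rightarrow> nat \<Rightarrow> complex poly poly"
  assumes "p \<noteq> 0"
    and "\<alpha>\<^sub>1 = 2 * p" and "\<alpha>h\<^sub>1 = p"
    and "\<beta>\<^sub>1 = 0" and "\<beta>h\<^sub>1 = 0"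
    and "\<gamma>\<^sub>1 = 1" and "\<gamma>h\<^sub>1 = -1"
  shows "lie_conformal_superalgebra gs_scale gs_grade
           (gs_br p \<alpha>\<^sub>1 \<beta>\<^sub>1 \<gamma>\<^sub>1 \<alpha>h\<^sub>1 \<beta>h\<^sub>1 \<gamma>h\<^sub>1 phi vphi) \<longleftrightarrow>
         (\<exists>\<Delta> :: complex. \<forall>i j.
            vphi i j = cst \<Delta> \<and>
            phi i j = cst \<Delta> *
              (cst (of_nat i + p) * del + cst (of_nat i + of_nat j + p) * lam))"
proof -
  let ?B = "gs_gen_br p (2 * p) 0 1 p 0 (- 1) phi vphi"
  let ?U = "\<lambda>i j. pe (phi i j)" and ?V = "\<lambda>i j. pe (vphi i j)"
  interpret gen_bracket ?B "\<lambda>a b. gens_at (gen_index a + gen_index b)"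
    by (rule gen_bracket_gs_gen_br)
  have br: "gs_br p \<alpha>\<^sub>1 \<beta>\<^sub>1 \<gamma>\<^sub>1 \<alpha>h\<^sub>1 \<beta>h\<^sub>1 \<gamma>h\<^sub>1 phi vphi = sesq_ext ?B"
    by (simp add: assms gs_br_eq_sesq_ext)
  show ?thesis
    unfolding br
  proof
    assume "lie_conformal_superalgebra gs_scale gs_grade (sesq_ext ?B)"
    note nec = structure_constants_necessary[OF assms(1) jacobi_on_gens[OF this, unfolded ev1_gs_gen_br]]
    show "\<exists>\<Delta>. \<forall>i j. vphi i j = cst \<Delta> \<and>
        phi i j = cst \<Delta> * (cst (of_nat i + p) * del + cst (of_nat i + of_nat j + p) * lam)"
    \<comment> \<open>The witness is left open here and is fixed by the goals below as the value of
      \<open>vphi 0 0\<close> at \<partial> = \<lambda> = 0.\<close>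
    proof (intro exI allI conjI; rule pe_eqI)
      fix i j d l
      show "pe (vphi i j) d l = pe (cst (pe (vphi 0 0) 0 0)) d l"
        using nec(1)[of i j d l] by simp
      show "pe (phi i j) d l = pe (cst (pe (vphi 0 0) 0 0) *
          (cst (of_nat i + p) * del + cst (of_nat i + of_nat j + p) * lam)) d l"
        using nec(2)[of i j d l] by simp
    qed
  next
    assume "\<exists>\<Delta>. \<forall>i j. vphi i j = cst \<Delta> \<and>
        phi i j = cst \<Delta> * (cst (of_nat i + p) * del + cst (of_nat i + of_nat j + p) * lam)"
    then obtain \<Delta> where
      V: "\<And>i j d l. ?V i j d l = \<Delta>" and
      U: "\<And>i j d l. ?U i j d l = \<Delta> * ((of_nat i + p) * d + (of_nat i + of_nat j + p) * l)"
      by auto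
    show "lie_conformal_superalgebra gs_scale gs_grade (sesq_ext ?B)"
      by (rule lie_conformal_superalgebra_sesq_ext; unfold ev1_gs_gen_br)
         (fact gs_const_parity gs_const_skew gs_const_jacobi[OF U V])+
  qed
qed

end
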